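(* Let $\Delta t>0$ and $N_t\in\mathbb{N}$, $N_t\ge 1$, be arbitrary, let $M>0$ and $0<\varepsilon\le 1$, and let $\phi^0=\phi_0$ be given on $\Omega$, with $R^0=\exp(E(\phi^0))$. Suppose that $(\phi^{n})_{0\le n\le N_t}$, $(\mu^{n+\frac12})_{0\le n\le N_t-1}$ (real-valued functions on $\Omega$) and $(R^n)_{0\le n\le N_t}$, $(\xi^n)_{1\le n\le N_t}$ (real numbers) satisfy the second-order Crank-Nicolson ESI-SAV scheme for the nonlocal Cahn-Hilliard equation: for all $0\le n\le N_t-1$, $$\frac{\phi^{n+1}-\phi^n}{\Delta t}=-M\mathcal{L}\mu^{n+\frac12},$$ $$\mu^{n+\frac12}=\varepsilon^2\mathcal{L}\frac{\phi^{n+1}+\phi^n}{2}+V(\xi^{n+1})f(\phi^{*,n+\frac12}),$$ $$\xi^{n+1}=\frac{R^{n+1}}{\exp\left(E(\phi^{*,n+\frac12})\right)},\qquad V(\xi^{n+1})=\xi^{n+1}(2-\xi^{n+1}),$$ $$\frac{R^{n+1}-R^n}{\Delta t}=R^{n+1}\left(-M\mathcal{L}\bar\mu^{n+\frac12},\bar\mu^{n+\frac12}\right),$$ where $\bar\mu^{n+\frac12}=\varepsilon^2\mathcal{L}\phi^{*,n+\frac12}+f(\phi^{*,n+\frac12})$ and $\phi^{*,n+\frac12}$ is any explicit $O(\Delta t^2)$ approximation of $\phi(t^{n+\frac12})$. Then the scheme is unconditionally energy stable, in the sense that, with no restriction on $\Delta t$, for all $0\le n\le N_t-1$, $$R^{n+1}-R^n=R^{n+1}\Delta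 t\left(-M\mathcal{L}\bar\mu^{n+\frac12},\bar\mu^{n+\frac12}\right)\le 0,$$ and moreover $$\ln R^{n+1}-\ln R^n\le 0.$$
   Context: $\Omega\subset\mathbb{R}^d$ ($d=1,2,3$) is a bounded rectangular cell. $(\phi,\varphi)=\int_\Omega\phi(\mathbf{x})\varphi(\mathbf{x})\,d\mathbf{x}$ is the $L^2(\Omega)$ inner product. All functions are real-valued. The interaction kernel $J$ is integrable on $\Omega$ and satisfies: (a) $J(\mathbf{x})\ge 0$ for all $\mathbf{x}\in\Omega$; (b) $J(\mathbf{x})=J(-\mathbf{x})$; (c) $J$ is $\Omega$-periodic (periodic in each coordinate with period the corresponding side length of $\Omega$); (d) $J$ is radial, meaning that on the period cell centred at the origin $J(\mathbf{x})$ depends only on $|\mathbf{x}|$. The nonlocal diffusion operator is $$\mathcal{L}\phi(\mathbf{x})=\int_\Omega J(\mathbf{x}-\mathbf{y})\left(\phi(\mathbf{x})-\phi(\mathbf{y})\right)d\mathbf{y},\quad \mathbf{x}\in\Omega.$$ $F:\mathbb{R}\to\mathbb{R}$ is a general nonlinear $C^1$ potential (typical example: $F(\phi)=\frac14(\phi^2-1)^2$) and $f=F'$. The free energy is $$E(\phi)=\frac{\varepsilon^2}{2}(\mathcal{L}\phi,\phi)+\int_\Omega F(\phi)\,d\mathbf{x}.$$ The nonlocal Cahn-Hilliard equation is $\partial_t\phi=-M\mathcal{L}\mu$, $\mu=\varepsilon^2\mathcal{L}\phi+f(\phi)$, with mobility constant $M>0$; $\phi(t)$ denotes its exact solution and $t^{n+\frac12}=(n+\frac12)\Delta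 t$. In the scheme, $R^n$ approximates the exponential scalar auxiliary variable $R(t)=\exp(E(\phi(t)))$. "Explicit $O(\Delta t^2)$ approximation" means: $\phi^{*,n+\frac12}$ is a function on $\Omega$ computed from $\phi^0,\dots,\phi^n$ whose error relative to $\phi(t^{n+\frac12})$ is of order $\Delta t^2$ as $\Delta t\to0$ (an asymptotic consistency requirement, imposing no condition for one fixed $\Delta t$). For example, $\phi^{*,n+\frac12}=\frac32\phi^n-\frac12\phi^{n-1}$ for $n\ge1$, and $\phi^{*,\frac12}$ defined by $\frac{\phi^{*,1/2}-\phi^0}{\Delta t/2}=-M\mathcal{L}\left(\varepsilon^2\mathcal{L}\phi^{*,\frac12}+f(\phi^0)\right)$. Functions are $\Omega$-periodic and assumed regular enough that all expressions are well defined; in particular $\phi^n$, $\phi^{*,n+\frac12}$, $f(\phi^{*,n+\frac12})$, $\mu^{n+\frac12}$, $\bar\mu^{n+\frac12}$ belong to $L^2(\Omega)$ and $E(\phi^0)$, $E(\phi^{*,n+\frac12})$ are finite. *)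

theory Defs
  imports "HOL-Analysis.Analysis"
begin

definition cell_periodic :: "real ^ 'd \<Rightarrow> (real ^ 'd \<Rightarrow> real) \<Rightarrow> bool" where
  "cell_periodic l u \<longleftrightarrow> (\<forall>x i. u (x + axis i (l $ i)) = u x)"

definition L2_on :: "(real ^ 'd) set \<Rightarrow> (real ^ 'd \<Rightarrow> real) \<Rightarrow> bool" where
  "L2_on \<Omega> u \<longleftrightarrow> set_borel_measurable lebesgue \<Omega> u \<and>
     set_integrable lebesgue \<Omega> (\<lambda>x. (u x)\<^sup>2)"

definition L2_inner :: "(real ^ 'd) set \<Rightarrow> (real ^ 'd \<Rightarrow> real) \<Rightarrow> (real ^ 'd \<Rightarrow> real) \<Rightarrow> real" where
  "L2_inner \<Omega> u v = (LINT x:\<Omega>|lebesgue. u x * v x)"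

definition L2_periodic :: "real ^ 'd \<Rightarrow> real ^ 'd \<Rightarrow> (real ^ 'd \<Rightarrow> real) \<Rightarrow> bool" where
  "L2_periodic a b u \<longleftrightarrow> cell_periodic (b - a) u \<and> L2_on (cbox a b) u"

text \<open>The last conjunct is radiality on the period cell centred at the origin.\<close>

definition interaction_kernel :: "real ^ 'd \<Rightarrow> real ^ 'd \<Rightarrow> (real ^ 'd \<Rightarrow> real) \<Rightarrow> bool" where
  "interaction_kernel a b J \<longleftrightarrow>
     set_integrable lebesgue (cbox a b) J \<and>
     (\<forall>x\<in>cbox a b. 0 \<le> J x) \<and>
     (\<forall>x. J x = J (- x)) \<and>
     cell_periodic (b - a) J \<and>
     (\<forall>x \<in> cbox (- ((1/2) *\<^sub>R (b - a))) ((1/2) *\<^sub>R (b - a)).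
      \<forall>y \<in> cbox (- ((1/2) *\<^sub>R (b - a))) ((1/2) *\<^sub>R (b - a)). norm x = norm y \<longrightarrow> J x = J y)"

definition C1_potential :: "(real \<Rightarrow> real) \<Rightarrow> (real \<Rightarrow> real) \<Rightarrow> bool" where
  "C1_potential F f \<longleftrightarrow>
     (\<forall>s. (F has_real_derivative f s) (at s)) \<and> continuous_on UNIV f"

definition nonlocal_diffusion ::
  "(real ^ 'd) set \<Rightarrow> (real ^ 'd \<Rightarrow> real) \<Rightarrow> (real ^ 'd \<Rightarrow> real) \<Rightarrow> real ^ 'd \<Rightarrow> real" where
  "nonlocal_diffusion \<Omega> J u x = (LINT y:\<Omega>|lebesgue. J (x - y) * (u x - u y))"

definition chemical_potential ::
  "(real ^ 'd) set \<Rightarrow> (real ^ 'd \<Rightarrow> real) \<Rightarrow> real \<Rightarrow> (real \<Rightarrow> real) \<Rightarrow>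
   (real ^ 'd \<Rightarrow> real) \<Rightarrow> real ^ 'd \<Rightarrow> real" where
  "chemical_potential \<Omega> J \<epsilon> f u x = \<epsilon>\<^sup>2 * nonlocal_diffusion \<Omega> J u x + f (u x)"

definition free_energy ::
  "(real ^ 'd) set \<Rightarrow> (real ^ 'd \<Rightarrow> real) \<Rightarrow> real \<Rightarrow> (real \<Rightarrow> real) \<Rightarrow> (real ^ 'd \<Rightarrow> real) \<Rightarrow> real" where
  "free_energy \<Omega> J \<epsilon> F u =
     \<epsilon>\<^sup>2 / 2 * L2_inner \<Omega> (nonlocal_diffusion \<Omega> J u) u + (LINT x:\<Omega>|lebesgue. F (u x))"

text \<open>The Bochner integral of a non-integrable function is 0, so finiteness of the energy
  has to be stated as integrability of its two integrands.\<close>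

definition finite_energy ::
  "(real ^ 'd) set \<Rightarrow> (real ^ 'd \<Rightarrow> real) \<Rightarrow> (real \<Rightarrow> real) \<Rightarrow> (real ^ 'd \<Rightarrow> real) \<Rightarrow> bool" where
  "finite_energy \<Omega> J F u \<longleftrightarrow>
     set_integrable lebesgue \<Omega> (\<lambda>x. nonlocal_diffusion \<Omega> J u x * u x) \<and>
     set_integrable lebesgue \<Omega> (\<lambda>x. F (u x))"

text \<open>A regular solution on \<open>[0, T]\<close> of the nonlocal Cahn-Hilliard equation with initial value
  \<open>u0\<close>; the bound on the second time derivative is the regularity under which
  second-order extrapolation in time has error \<open>O(\<tau>\<^sup>2)\<close>.\<close>

definition NCH_solution ::
  "real ^ 'd \<Rightarrow> real ^ 'd \<Rightarrow> (real ^ 'd \<Rightarrow> real) \<Rightarrow> (real \<Rightarrow> real) \<Rightarrow> real \<Rightarrow> real \<Rightarrow>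
   (real ^ 'd \<Rightarrow> real) \<Rightarrow> real \<Rightarrow> (real \<Rightarrow> real ^ 'd \<Rightarrow> real) \<Rightarrow> bool" where
  "NCH_solution a b J f M \<epsilon> u0 T u \<longleftrightarrow>
     (\<forall>x\<in>cbox a b. u 0 x = u0 x) \<and>
     (\<forall>t\<in>{0..T}. L2_periodic a b (u t) \<and> L2_on (cbox a b) (\<lambda>x. f (u t x))) \<and>
     (\<exists>u' u'' K. \<forall>t\<in>{0..T}. \<forall>x\<in>cbox a b.
        ((\<lambda>s. u s x) has_real_derivative u' t x) (at t within {0..T}) \<and>
        ((\<lambda>s. u' s x) has_real_derivative u'' t x) (at t within {0..T}) \<and>
        \<bar>u'' t x\<bar> \<le> K \<and>
        u' t x = - M * nonlocal_diffusion (cbox a b) J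
                         (chemical_potential (cbox a b) J \<epsilon> f (u t)) x)"

text \<open>\<open>ext \<tau> n [v\<^sub>0, \<dots>, v\<^sub>n]\<close> is the half-step approximation computed explicitly, with step
  size \<open>\<tau>\<close>, from the values at the times \<open>0, \<tau>, \<dots>, n\<tau>\<close>. Its order is a consistency condition
  as \<open>\<tau>\<close> tends to 0: on exact data it reproduces the solution at time \<open>(n + 1/2)\<tau>\<close> up to
  \<open>O(\<tau>\<^sup>2)\<close> in the \<open>L\<^sup>2\<close> norm, uniformly in \<open>n\<close>. The quantification over solutions means that
  no existence or uniqueness of solutions is presupposed.\<close>

definition explicit_second_order_approx ::
  "real ^ 'd \<Rightarrow> real ^ 'd \<Rightarrow> (real ^ 'd \<Rightarrow> real) \<Rightarrow> (real \<Rightarrow> real) \<Rightarrow> real \<Rightarrow> real \<Rightarrow>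
   (real ^ 'd \<Rightarrow> real) \<Rightarrow>
   (real \<Rightarrow> nat \<Rightarrow> (real ^ 'd \<Rightarrow> real) list \<Rightarrow> real ^ 'd \<Rightarrow> real) \<Rightarrow> bool" where
  "explicit_second_order_approx a b J f M \<epsilon> u0 ext \<longleftrightarrow>
     (\<forall>T>0. \<forall>u. NCH_solution a b J f M \<epsilon> u0 T u \<longrightarrow>
        (\<exists>C. \<forall>\<^sub>F \<tau> in at_right 0. \<forall>n. (real n + 1) * \<tau> \<le> T \<longrightarrow>
           (let e = (\<lambda>x. ext \<tau> n (map (\<lambda>k. u (real k * \<tau>)) [0..<Suc n]) x
                           - u ((real n + 1/2) * \<tau>) x)
            in L2_on (cbox a b) e \<and> sqrt (L2_inner (cbox a b) e e) \<le> C * \<tau>\<^sup>2)))"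

definition sav_V :: "real \<Rightarrow> real" where
  "sav_V \<xi> = \<xi> * (2 - \<xi>)"

text \<open>The Crank-Nicolson ESI-SAV scheme with given half-step approximations \<open>\<phi>s n\<close>.
  \<open>\<mu> n\<close>, \<open>\<phi>s n\<close> and \<open>\<mu>b\<close> carry the time index \<open>n + 1/2\<close>; \<open>\<xi> n\<close> is used for \<open>n \<ge> 1\<close> only.
  Identities between square-integrable functions hold almost everywhere.\<close>

definition CN_ESI_SAV_scheme ::
  "(real ^ 'd) set \<Rightarrow> (real ^ 'd \<Rightarrow> real) \<Rightarrow> (real \<Rightarrow> real) \<Rightarrow> (real \<Rightarrow> real) \<Rightarrow> real \<Rightarrow> real \<Rightarrow>
   real \<Rightarrow> nat \<Rightarrow> (nat \<Rightarrow> real ^ 'd \<Rightarrow> real) \<Rightarrow>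
   (nat \<Rightarrow> real ^ 'd \<Rightarrow> real) \<Rightarrow> (nat \<Rightarrow> real ^ 'd \<Rightarrow> real) \<Rightarrow> (nat \<Rightarrow> real) \<Rightarrow> (nat \<Rightarrow> real) \<Rightarrow> bool" where
  "CN_ESI_SAV_scheme \<Omega> J F f M \<epsilon> \<Delta>t Nt \<phi>s \<phi> \<mu> R \<xi> \<longleftrightarrow>
     (\<forall>n<Nt.
        (AE x in lebesgue_on \<Omega>. (\<phi> (n + 1) x - \<phi> n x) / \<Delta>t = - M * nonlocal_diffusion \<Omega> J (\<mu> n) x) \<and>
        (AE x in lebesgue_on \<Omega>.
           \<mu> n x = \<epsilon>\<^sup>2 * nonlocal_diffusion \<Omega> J (\<lambda>y. (\<phi> (n + 1) y + \<phi> n y) / 2) x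
                    + sav_V (\<xi> (n + 1)) * f (\<phi>s n x)) \<and>
        \<xi> (n + 1) = R (n + 1) / exp (free_energy \<Omega> J \<epsilon> F (\<phi>s n)) \<and>
        (let \<mu>b = chemical_potential \<Omega> J \<epsilon> f (\<phi>s n) in
           (R (n + 1) - R n) / \<Delta>t
             = R (n + 1) * L2_inner \<Omega> (\<lambda>x. - M * nonlocal_diffusion \<Omega> J \<mu>b x) \<mu>b))"

end

theory Submission
  imports Defs
begin

text \<open>
  Everything rests on the fact that the nonlocal diffusion operator is positive semidefinite on
  square-integrable functions. Exchanging the two variables in the double integral
  \<open>(\<L>w, w) = \<integral>\<integral> J(x - y) (w(x) - w(y)) w(x) dy dx\<close> and averaging the two forms gives, since \<open>J\<close> is
  even, \<open>(\<L>w, w) = 1/2 \<integral>\<integral> J(x - y) (w(x) - w(y))\<^sup>2 dy dx \<ge> 0\<close>.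

  Applied to the half-step chemical potential, this says that the update of the auxiliary variable
  has the form \<open>R (n + 1) - R n = - c * R (n + 1)\<close> with \<open>c \<ge> 0\<close>, that is
  \<open>R (n + 1) = R n / (1 + c)\<close>. Because \<open>R 0\<close> is an exponential, all \<open>R n\<close> are positive by induction,
  and then they are nonincreasing, whatever the step size is.

  The analytic work is in justifying the exchange of the integrals. The lemma
  \<open>symmetric_kernel_form_nonneg\<close> does so for a symmetric kernel with uniformly bounded marginals on
  a \<sigma>-finite measure space. To apply it, the kernel must be measurable on the product space, which
  composing a Lebesgue measurable \<open>J\<close> with subtraction does not give directly; so
  \<open>difference_kernel_form_nonneg\<close> passes to Borel functions that agree with the data almost
  everywhere. Finally, differences of points of the cell leave the cell, and the integrability and
  the sign of \<open>J\<close> have to be carried to the larger box of differences by periodicity.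
\<close>

section \<open>Quadratic forms of symmetric kernels\<close>

text \<open>The Dirichlet form of a symmetric nonnegative kernel. The marginal bound, as in Schur's test,
  makes \<open>K x y * (u x)\<^sup>2\<close> and, by symmetry, \<open>K x y * (u y)\<^sup>2\<close> integrable on the product, and these
  dominate the integrand; hence Fubini applies and the variables may be exchanged.\<close>

lemma (in sigma_finite_measure) symmetric_kernel_form_nonneg:
  fixes K :: "'a \<Rightarrow> 'a \<Rightarrow> real" and u :: "'a \<Rightarrow> real"
  assumes K[measurable]: "case_prod K \<in> borel_measurable (M \<Otimes>\<^sub>M M)"
    and nonneg: "\<And>x y. 0 \<le> K x y"
    and sym: "\<And>x y. K x y = K y x"
    and int: "\<And>x. integrable M (K x)"
    and bound: "\<And>x. (\<integral>y. K x y \<partial>M) \<le> C"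
    and u[measurable]: "u \<in> borel_measurable M"
    and u2: "integrable M (\<lambda>x. (u x)\<^sup>2)"
  shows "0 \<le> (\<integral>x. (\<integral>y. K x y * (u x - u y) \<partial>M) * u x \<partial>M)"
proof -
  interpret P: pair_sigma_finite M M ..
  define G where "G x y = K x y * (u x - u y) * u x" for x y
  have G_meas: "case_prod G \<in> borel_measurable (M \<Otimes>\<^sub>M M)"
    unfolding G_def by measurable
  have diag: "integrable (M \<Otimes>\<^sub>M M) (\<lambda>(x, y). K x y * (u x)\<^sup>2)"
  proof (rule P.Fubini_integrable)
    have "integrable M (\<lambda>x. (\<integral>y. K x y \<partial>M) * (u x)\<^sup>2)"
    proof (rule Bochner_Integration.integrable_bound)
      show "integrable M (\<lambda>x. C * (u x)\<^sup>2)" using u2 by simp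
      show "AE x in M. norm ((\<integral>y. K x y \<partial>M) * (u x)\<^sup>2) \<le> norm (C * (u x)\<^sup>2)"
      proof (rule AE_I2)
        fix x
        have "0 \<le> (\<integral>y. K x y \<partial>M)" by (simp add: nonneg)
        with bound[of x]
        show "norm ((\<integral>y. K x y \<partial>M) * (u x)\<^sup>2) \<le> norm (C * (u x)\<^sup>2)"
          by (simp add: abs_mult mult_right_mono)
      qed
    qed measurable
    then show "integrable M (\<lambda>x. \<integral>y. norm (case (x, y) of (x, y) \<Rightarrow> K x y * (u x)\<^sup>2) \<partial>M)"
      by (simp add: abs_mult nonneg)
  qed (use int in \<open>simp_all add: case_prod_beta\<close>)
  have diag': "integrable (M \<Otimes>\<^sub>M M) (\<lambda>(x, y). K x y * (u y)\<^sup>2)"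
    using P.integrable_product_swap[OF diag] by (simp add: sym case_prod_beta)
  have G_int: "integrable (M \<Otimes>\<^sub>M M) (case_prod G)"
  proof (rule Bochner_Integration.integrable_bound)
    show "integrable (M \<Otimes>\<^sub>M M)
        (\<lambda>p. 2 * (case p of (x, y) \<Rightarrow> K x y * (u x)\<^sup>2) + (case p of (x, y) \<Rightarrow> K x y * (u y)\<^sup>2))"
      using diag diag' by (intro Bochner_Integration.integrable_add integrable_mult_right)
    have le: "\<bar>(s - t) * s\<bar> \<le> 2 * s\<^sup>2 + t\<^sup>2" for s t :: real
    proof -
      have "0 \<le> (s - t)\<^sup>2" "0 \<le> (s + t)\<^sup>2" "0 \<le> s\<^sup>2" "0 \<le> t\<^sup>2" by simp_all
      then have "s * t \<le> s\<^sup>2 + t\<^sup>2" "- (s * t) \<le> s\<^sup>2 + t\<^sup>2"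
        unfolding power2_diff power2_sum by linarith+
      moreover have "(s - t) * s = s\<^sup>2 - s * t" by (simp add: power2_eq_square algebra_simps)
      ultimately show ?thesis using \<open>0 \<le> s\<^sup>2\<close> \<open>0 \<le> t\<^sup>2\<close> by linarith
    qed
    show "AE p in M \<Otimes>\<^sub>M M. norm (case_prod G p) \<le>
        norm (2 * (case p of (x, y) \<Rightarrow> K x y * (u x)\<^sup>2) + (case p of (x, y) \<Rightarrow> K x y * (u y)\<^sup>2))"
    proof (rule AE_I2, clarify)
      fix x y
      have "\<bar>G x y\<bar> = K x y * \<bar>(u x - u y) * u x\<bar>"
        by (simp add: G_def abs_mult nonneg mult.assoc)
      also have "\<dots> \<le> K x y * (2 * (u x)\<^sup>2 + (u y)\<^sup>2)"
        by (intro mult_left_mono le nonneg)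
      finally show "norm (G x y) \<le> norm (2 * (K x y * (u x)\<^sup>2) + K x y * (u y)\<^sup>2)"
        by (simp add: algebra_simps)
    qed
  qed (rule G_meas)
  have G_int': "integrable (M \<Otimes>\<^sub>M M) (\<lambda>(x, y). G y x)"
    using P.integrable_product_swap[OF G_int] by simp
  let ?I = "integral\<^sup>L (M \<Otimes>\<^sub>M M) (case_prod G)"
  have "(\<integral>x. (\<integral>y. K x y * (u x - u y) \<partial>M) * u x \<partial>M) = (\<integral>x. (\<integral>y. G x y \<partial>M) \<partial>M)"
    by (simp add: G_def)
  also have "\<dots> = ?I" by (rule P.integral_fst[OF G_int])
  finally have eq: "(\<integral>x. (\<integral>y. K x y * (u x - u y) \<partial>M) * u x \<partial>M) = ?I" .
  have "2 * ?I = ?I + integral\<^sup>L (M \<Otimes>\<^sub>M M) (\<lambda>(x, y). G y x)"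
    using P.integral_product_swap[OF G_meas] by simp
  also have "\<dots> = (\<integral>p. case_prod G p + (case p of (x, y) \<Rightarrow> G y x) \<partial>(M \<Otimes>\<^sub>M M))"
    by (rule Bochner_Integration.integral_add[symmetric, OF G_int G_int'])
  also have "\<dots> = (\<integral>(x, y). K x y * (u x - u y)\<^sup>2 \<partial>(M \<Otimes>\<^sub>M M))"
  proof (rule Bochner_Integration.integral_cong[OF refl], clarify)
    fix x y
    show "G x y + G y x = K x y * (u x - u y)\<^sup>2"
      by (simp add: G_def sym[of y x] power2_eq_square algebra_simps)
  qed
  also have "\<dots> \<ge> 0"
    by (rule Bochner_Integration.integral_nonneg) (auto simp: nonneg)
  finally show ?thesis using eq by simp
qed

section \<open>Translations, reflections and Borel versions\<close>

text \<open>The case \<open>s = 1\<close> is a translation; the case \<open>s = -1\<close> is the reflection \<open>x \<mapsto> t - x\<close>, which occurs in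
  convolutions.\<close>

lemma lebesgue_measurable_isometry:
  fixes t :: "'a::euclidean_space" and s :: real
  assumes "\<bar>s\<bar> = 1"
  shows "(\<lambda>x. t + s *\<^sub>R x) \<in> lebesgue \<rightarrow>\<^sub>M lebesgue"
    and "distr lebesgue lebesgue (\<lambda>x. t + s *\<^sub>R x) = lebesgue"
proof -
  have T: "t + (\<Sum>j\<in>Basis. (s * (x \<bullet> j)) *\<^sub>R j) = t + s *\<^sub>R x" for x
    unfolding scaleR_scaleR[symmetric] scaleR_sum_right[symmetric] euclidean_representation ..
  have s: "s \<noteq> 0" using assms by auto
  show "(\<lambda>x. t + s *\<^sub>R x) \<in> lebesgue \<rightarrow>\<^sub>M lebesgue"
    using lebesgue_affine_measurable[of "\<lambda>_. s" t] s by (simp add: T)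
  show "distr lebesgue lebesgue (\<lambda>x. t + s *\<^sub>R x) = lebesgue"
    using lebesgue_affine_euclidean[of "\<lambda>_. s" t] s assms by (simp add: T density_1)
qed

lemma
  fixes t :: "'a::euclidean_space" and s :: real
  assumes s: "\<bar>s\<bar> = 1"
  shows AE_lebesgue_isometry:
      "(AE x in lebesgue. P x) \<Longrightarrow> AE x in lebesgue. P (t + s *\<^sub>R x)"
    and integrable_lebesgue_isometry:
      "integrable lebesgue (f :: 'a \<Rightarrow> real) \<Longrightarrow> integrable lebesgue (\<lambda>x. f (t + s *\<^sub>R x))"
    and integral_lebesgue_isometry:
      "integrable lebesgue (f :: 'a \<Rightarrow> real) \<Longrightarrow>
        (\<integral>x. f (t + s *\<^sub>R x) \<partial>lebesgue) = (\<integral>x. f x \<partial>lebesgue)"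
proof -
  note T = lebesgue_measurable_isometry[OF s, of t]
  show "AE x in lebesgue. P (t + s *\<^sub>R x)" if "AE x in lebesgue. P x"
    by (rule AE_distrD[OF T(1)]) (simp only: T(2) that)
  show "integrable lebesgue (\<lambda>x. f (t + s *\<^sub>R x))" if "integrable lebesgue f"
    by (rule integrable_distr[OF T(1)]) (simp only: T(2) that)
  show "(\<integral>x. f (t + s *\<^sub>R x) \<partial>lebesgue) = (\<integral>x. f x \<partial>lebesgue)" if "integrable lebesgue f"
    using integral_distr[OF T(1), of f] that by (simp add: T(2))
qed

lemma integrable_lebesgue_Borel_version:
  fixes f :: "'a::euclidean_space \<Rightarrow> real"
  assumes "integrable lebesgue f"
  obtains g where "g \<in> borel_measurable borel" "integrable lborel g" "AE x in lebesgue. f x = g x"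
proof -
  obtain g where g: "g \<in> borel_measurable lborel" "AE x in lborel. f x = g x"
    using completion_ex_borel_measurable_real[of f lborel] assms by auto
  from g(2) have ae: "AE x in lebesgue. f x = g x" by (simp add: AE_completion_iff)
  have "integrable lebesgue g"
    using integrable_cong_AE[of f lebesgue g] ae assms g(1)
    by (simp add: measurable_completion)
  with g ae show ?thesis by (intro that[of g]) (simp_all add: integrable_completion)
qed

section \<open>Quadratic forms of difference kernels\<close>

text \<open>Replacing \<open>k\<close> and \<open>w\<close> by Borel versions leaves the inner integral unchanged at every \<open>x\<close> in \<open>A\<close>
  where the two versions of \<open>w\<close> agree, because \<open>y \<mapsto> x - y\<close> preserves null sets. The marginals of the resulting kernel are
  bounded by the integral of \<open>k\<close> over the whole space.\<close>

lemma difference_kernel_form_nonneg: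
  fixes k w :: "real ^ 'd \<Rightarrow> real"
  assumes k: "integrable lebesgue k" "\<And>z. 0 \<le> k z" "\<And>z. k (- z) = k z"
    and A[measurable]: "A \<in> sets borel"
    and w: "L2_on A w"
  shows "0 \<le> (LINT x:A|lebesgue. (LINT y:A|lebesgue. k (x - y) * (w x - w y)) * w x)"
proof -
  obtain g0 where g0[measurable]: "g0 \<in> borel_measurable borel"
    and g0_int: "integrable lborel g0" and g0_ae: "AE z in lebesgue. k z = g0 z"
    using integrable_lebesgue_Borel_version[OF k(1)] .
  \<comment> \<open>A Borel version of \<open>k\<close> is even and nonnegative only almost everywhere; averaging the absolute
    values over the reflection restores both properties at every point.\<close>
  define g where "g z = (\<bar>g0 z\<bar> + \<bar>g0 (- z)\<bar>) / 2" for z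
  have g[measurable]: "g \<in> borel_measurable borel" unfolding g_def by measurable
  have g0_ae': "AE z in lebesgue. k (0 + (-1) *\<^sub>R z) = g0 (0 + (-1) *\<^sub>R z)"
    by (rule AE_lebesgue_isometry[OF _ g0_ae]) simp
  have g_ae: "AE z in lebesgue. k z = g z"
    using g0_ae g0_ae'
  proof eventually_elim
    case (elim z)
    then have "g0 z = k z" "g0 (- z) = k z" using k(3)[of z] by simp_all
    with k(2)[of z] show ?case by (simp add: g_def)
  qed
  have g_leb: "integrable lebesgue g"
    using integrable_cong_AE[of k lebesgue g] g_ae k(1) by (simp add: measurable_completion)
  have g_shift: "integrable lborel (\<lambda>y. g (x - y))"
       "(\<integral>y. g (x - y) \<partial>lborel) = (\<integral>y. g y \<partial>lborel)" for x
    using integrable_lebesgue_isometry[OF _ g_leb, of "-1" x]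
      integral_lebesgue_isometry[OF _ g_leb, of "-1" x]
    by (simp_all add: integrable_completion integral_completion)
  define wA where "wA x = indicator A x *\<^sub>R w x" for x
  have wA_meas: "wA \<in> borel_measurable lebesgue"
    using w unfolding L2_on_def set_borel_measurable_def wA_def by simp
  obtain u where u[measurable]: "u \<in> borel_measurable borel" and "AE x in lborel. wA x = u x"
    using completion_ex_borel_measurable_real[of wA lborel] wA_meas by auto
  then have u_ae: "AE x in lebesgue. wA x = u x" by (simp add: AE_completion_iff)
  have u2: "integrable lborel (\<lambda>x. (u x)\<^sup>2)"
  proof -
    have "integrable lebesgue (\<lambda>x. indicator A x *\<^sub>R (w x)\<^sup>2)"
      using w unfolding L2_on_def set_integrable_def by simp
    also have "(\<lambda>x. indicator A x *\<^sub>R (w x)\<^sup>2) = (\<lambda>x. (wA x)\<^sup>2)"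
      by (auto simp: wA_def fun_eq_iff indicator_def)
    finally have i: "integrable lebesgue (\<lambda>x. (wA x)\<^sup>2)" .
    have "integrable lebesgue (\<lambda>x. (u x)\<^sup>2)"
      by (rule integrable_cong_AE_imp[OF i]) (use u_ae in \<open>auto simp: measurable_completion\<close>)
    then show ?thesis by (simp add: integrable_completion)
  qed
  define K where "K x y = indicator A x * indicator A y * g (x - y)" for x y
  have K_meas: "case_prod K \<in> borel_measurable (lborel \<Otimes>\<^sub>M lborel)"
    unfolding K_def by measurable
  have K_nonneg: "0 \<le> K x y" for x y by (simp add: K_def g_def)
  have K_int: "integrable lborel (K x)" for x
    unfolding K_def
    by (rule Bochner_Integration.integrable_bound[OF g_shift(1)[of x]])
      (auto simp: indicator_def g_def)
  have K_bound: "(\<integral>y. K x y \<partial>lborel) \<le> (\<integral>y. g y \<partial>lborel)" for x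
    unfolding g_shift(2)[of x, symmetric]
    by (rule integral_mono[OF K_int g_shift(1)]) (auto simp: K_def g_def indicator_def)
  have K_sym: "K x y = K y x" for x y
    by (simp add: K_def g_def)
  have pos: "0 \<le> (\<integral>x. (\<integral>y. K x y * (u x - u y) \<partial>lborel) * u x \<partial>lborel)"
    by (rule lborel.symmetric_kernel_form_nonneg[OF K_meas K_nonneg K_sym K_int K_bound _ u2]) simp
  define H where "H x = (\<integral>y. K x y * (u x - u y) \<partial>lborel) * u x" for x
  have H_meas: "H \<in> borel_measurable borel"
    using K_meas unfolding H_def by measurable
  have inner: "(LINT y:A|lebesgue. k (x - y) * (w x - w y)) = (\<integral>y. K x y * (u x - u y) \<partial>lborel)"
    if x: "x \<in> A" "wA x = u x" for x
  proof -
    have Kx_meas: "(\<lambda>y. K x y * (u x - u y)) \<in> borel_measurable borel"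
      unfolding K_def by measurable
    have shift: "AE y in lebesgue. k (x + (-1) *\<^sub>R y) = g (x + (-1) *\<^sub>R y)"
      by (rule AE_lebesgue_isometry[OF _ g_ae]) simp
    have ae: "AE y in lebesgue. K x y * (u x - u y) = indicator A y *\<^sub>R (k (x - y) * (w x - w y))"
      using u_ae shift
    proof eventually_elim
      case (elim y)
      then show ?case using x by (auto simp: K_def wA_def indicator_def)
    qed
    have "(LINT y:A|lebesgue. k (x - y) * (w x - w y)) = (\<integral>y. K x y * (u x - u y) \<partial>lebesgue)"
      unfolding set_lebesgue_integral_def
      using ae Kx_meas
      by (intro integral_cong_AE borel_measurable_AE[OF _ ae])
        (auto simp: measurable_completion elim: eventually_mono)
    then show ?thesis using Kx_meas by (simp add: integral_completion)
  qed
  have ae: "AE x in lebesgue.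
      H x = indicator A x *\<^sub>R ((LINT y:A|lebesgue. k (x - y) * (w x - w y)) * w x)"
    using u_ae
  proof eventually_elim
    case (elim x)
    then show ?case
      using inner[of x] by (cases "x \<in> A") (simp_all add: H_def wA_def)
  qed
  have "(LINT x:A|lebesgue. (LINT y:A|lebesgue. k (x - y) * (w x - w y)) * w x)
      = (\<integral>x. H x \<partial>lebesgue)"
    unfolding set_lebesgue_integral_def[of lebesgue A "\<lambda>x. (LINT y:A|lebesgue. k (x - y) * (w x - w y)) * w x"]
    using ae H_meas
    by (intro integral_cong_AE borel_measurable_AE[OF _ ae])
      (auto simp: measurable_completion elim: eventually_mono)
  also have "\<dots> = (\<integral>x. H x \<partial>lborel)" using H_meas by (simp add: integral_completion)
  finally show ?thesis using pos by (simp add: H_def)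
qed

section \<open>Periodic functions\<close>

definition lattice_point :: "real ^ 'd \<Rightarrow> ('d \<Rightarrow> int) \<Rightarrow> real ^ 'd" where
  "lattice_point l m = (\<chi> i. of_int (m i) * l $ i)"

lemma cell_periodic_lattice_point:
  fixes u :: "real ^ 'd \<Rightarrow> real"
  assumes per: "cell_periodic l u"
  shows "u (x - lattice_point l m) = u x"
proof -
  have up: "u (x + real n *\<^sub>R axis i (l $ i)) = u x" for x n i
  proof (induction n arbitrary: x)
    case (Suc n)
    have "u (x + real (Suc n) *\<^sub>R axis i (l $ i))
        = u ((x + real n *\<^sub>R axis i (l $ i)) + axis i (l $ i))"
      by (simp add: algebra_simps)
    with Suc per show ?case by (simp add: cell_periodic_def)
  qed simp
  have one: "u (x + of_int j *\<^sub>R axis i (l $ i)) = u x" for x j i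
  proof (cases "0 \<le> j")
    case True
    then show ?thesis using up[of x "nat j" i] by simp
  next
    case False
    then show ?thesis using up[of "x + of_int j *\<^sub>R axis i (l $ i)" "nat (- j)" i] by simp
  qed
  have "u (x + (\<Sum>i\<in>S. of_int (m i) *\<^sub>R axis i (l $ i))) = u x" if "finite S" for S x
    using that
  proof induction
    case (insert i S)
    have "u (x + (\<Sum>i\<in>insert i S. of_int (m i) *\<^sub>R axis i (l $ i)))
        = u ((x + (\<Sum>i\<in>S. of_int (m i) *\<^sub>R axis i (l $ i))) + of_int (m i) *\<^sub>R axis i (l $ i))"
      using insert by (simp add: algebra_simps)
    with one insert show ?case by simp
  qed simp
  then have "u (y + (\<Sum>i\<in>UNIV. of_int (m i) *\<^sub>R axis i (l $ i))) = u y" for y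
    by simp
  moreover have "(\<Sum>i\<in>UNIV. of_int (m i) *\<^sub>R axis i (l $ i)) = lattice_point l m"
    by (simp add: lattice_point_def vec_eq_iff axis_def if_distrib cong: if_cong)
  ultimately have "u (x - lattice_point l m + lattice_point l m) = u (x - lattice_point l m)"
    by metis
  then show ?thesis by simp
qed

text \<open>Rounding down in each coordinate selects the translate of the cell that contains \<open>x\<close>; the translates
  tile the space.\<close>

lemma mem_cbox_minus_lattice_point:
  fixes a b x :: "real ^ 'd"
  assumes ab: "\<forall>i. a $ i < b $ i"
  shows "x - lattice_point (b - a) (\<lambda>i. \<lfloor>(x $ i - a $ i) / (b $ i - a $ i)\<rfloor>) \<in> cbox a b"
proof -
  define m where "m i = \<lfloor>(x $ i - a $ i) / (b $ i - a $ i)\<rfloor>" for i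
  have "a $ i + m i * (b $ i - a $ i) \<le> x $ i \<and> x $ i \<le> b $ i + m i * (b $ i - a $ i)" for i
  proof -
    have pos: "0 < b $ i - a $ i" using ab by simp
    have "m i \<le> (x $ i - a $ i) / (b $ i - a $ i)" "(x $ i - a $ i) / (b $ i - a $ i) < m i + 1"
      unfolding m_def by linarith+
    then have "m i * (b $ i - a $ i) \<le> x $ i - a $ i" "x $ i - a $ i < (m i + 1) * (b $ i - a $ i)"
      using pos by (simp_all add: pos_le_divide_eq pos_divide_less_eq)
    then show ?thesis by (simp add: algebra_simps)
  qed
  then have "x - lattice_point (b - a) m \<in> cbox a b"
    by (simp add: mem_box_cart lattice_point_def le_diff_eq diff_le_eq)
  then show ?thesis by (simp add: m_def[abs_def])
qed

lemma cell_periodic_nonneg: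
  fixes u :: "real ^ 'd \<Rightarrow> real"
  assumes ab: "\<forall>i. a $ i < b $ i"
    and per: "cell_periodic (b - a) u"
    and pos: "\<forall>x\<in>cbox a b. 0 \<le> u x"
  shows "0 \<le> u x"
  using pos mem_cbox_minus_lattice_point[OF ab, of x] cell_periodic_lattice_point[OF per] by metis

text \<open>Finitely many translates of the cell cover any given box, and the function is integrable on
  each of them.\<close>

lemma cell_periodic_integrable_on_cbox:
  fixes u :: "real ^ 'd \<Rightarrow> real"
  assumes ab: "\<forall>i. a $ i < b $ i"
    and per: "cell_periodic (b - a) u"
    and int: "set_integrable lebesgue (cbox a b) u"
  shows "set_integrable lebesgue (cbox c d) u"
proof -
  let ?p = "lattice_point (b - a)"
  define S where "S = (\<Pi>\<^sub>E i\<in>(UNIV :: 'd set).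
      {\<lfloor>(c $ i - a $ i) / (b $ i - a $ i)\<rfloor> .. \<lfloor>(d $ i - a $ i) / (b $ i - a $ i)\<rfloor>})"
  have fin: "finite S" unfolding S_def by (intro finite_PiE) auto
  have cell_iff: "x - ?p m \<in> cbox a b \<longleftrightarrow> x \<in> cbox (a + ?p m) (b + ?p m)" for x m
    by (simp add: mem_box_cart le_diff_eq diff_le_eq)
  have cover: "cbox c d \<subseteq> (\<Union>m\<in>S. cbox (a + ?p m) (b + ?p m))"
  proof
    fix x assume x: "x \<in> cbox c d"
    define m where "m = (\<lambda>i. \<lfloor>(x $ i - a $ i) / (b $ i - a $ i)\<rfloor>)"
    have "\<lfloor>(c $ i - a $ i) / (b $ i - a $ i)\<rfloor> \<le> m i \<and> m i \<le> \<lfloor>(d $ i - a $ i) / (b $ i - a $ i)\<rfloor>" for i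
    proof -
      have "c $ i \<le> x $ i" "x $ i \<le> d $ i" "0 < b $ i - a $ i"
        using x ab by (auto simp: mem_box_cart)
      then show ?thesis
        unfolding m_def by (intro conjI floor_mono divide_right_mono) simp_all
    qed
    then have "m \<in> S" by (auto simp: S_def PiE_iff)
    moreover have "x \<in> cbox (a + ?p m) (b + ?p m)"
      using mem_cbox_minus_lattice_point[OF ab, of x] by (simp only: m_def cell_iff)
    ultimately show "x \<in> (\<Union>m\<in>S. cbox (a + ?p m) (b + ?p m))" by blast
  qed
  have piece: "set_integrable lebesgue (cbox (a + ?p m) (b + ?p m)) u" for m
  proof -
    have "integrable lebesgue (\<lambda>x. indicator (cbox a b) (- ?p m + 1 *\<^sub>R x) *\<^sub>R u (- ?p m + 1 *\<^sub>R x))"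
      using int unfolding set_integrable_def by (intro integrable_lebesgue_isometry) simp_all
    moreover have "- ?p m + 1 *\<^sub>R x = x - ?p m" for x by simp
    ultimately show ?thesis
      unfolding set_integrable_def
      by (simp add: indicator_def cell_iff cell_periodic_lattice_point[OF per])
  qed
  have "set_integrable lebesgue (\<Union>m\<in>S. cbox (a + ?p m) (b + ?p m)) u"
    by (rule set_integrable_UN[OF fin piece]) simp
  then show ?thesis by (rule set_integrable_subset[OF _ _ cover]) simp
qed

section \<open>Positivity of the nonlocal diffusion operator\<close>

text \<open>Differences of points of the cell stay in the symmetric box \<open>cbox (a - b) (b - a)\<close>, so cutting
  \<open>J\<close> off outside this box leaves the operator unchanged on the cell and makes the kernel integrable over the
  whole space.\<close>

lemma nonlocal_diffusion_nonneg:
  fixes J w :: "real ^ 'd \<Rightarrow> real"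
  assumes ab: "\<forall>i. a $ i < b $ i"
    and J: "interaction_kernel a b J"
    and w: "L2_on (cbox a b) w"
  shows "0 \<le> L2_inner (cbox a b) (nonlocal_diffusion (cbox a b) J w) w"
proof -
  have per: "cell_periodic (b - a) J" and int: "set_integrable lebesgue (cbox a b) J"
    and pos: "\<forall>x\<in>cbox a b. 0 \<le> J x" and even: "J (- z) = J z" for z
    using J unfolding interaction_kernel_def by auto
  define k where "k z = indicator (cbox (a - b) (b - a)) z *\<^sub>R J z" for z
  have "integrable lebesgue k"
    using cell_periodic_integrable_on_cbox[OF ab per int, of "a - b" "b - a"]
    unfolding set_integrable_def k_def .
  moreover have "0 \<le> k z" for z
    using cell_periodic_nonneg[OF ab per pos, of z] by (simp add: k_def)
  moreover have "k (- z) = k z" for z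
  proof -
    have "- z \<in> cbox (a - b) (b - a) \<longleftrightarrow> z \<in> cbox (a - b) (b - a)"
      by (auto simp: mem_box_cart) (smt (verit))+
    then show ?thesis by (simp add: k_def even indicator_def)
  qed
  ultimately have nonneg:
    "0 \<le> (LINT x:cbox a b|lebesgue. (LINT y:cbox a b|lebesgue. k (x - y) * (w x - w y)) * w x)"
    by (rule difference_kernel_form_nonneg) (simp_all add: w)
  have k_eq: "k (x - y) = J (x - y)" if "x \<in> cbox a b" "y \<in> cbox a b" for x y
  proof -
    have "x - y \<in> cbox (a - b) (b - a)"
      using that by (auto simp: mem_box_cart intro!: diff_mono)
    then show ?thesis by (simp add: k_def)
  qed
  have inner: "(LINT y:cbox a b|lebesgue. k (x - y) * (w x - w y)) = nonlocal_diffusion (cbox a b) J w x"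
    if "x \<in> cbox a b" for x
    unfolding nonlocal_diffusion_def
    by (rule set_lebesgue_integral_cong) (simp_all add: k_eq that)
  have "L2_inner (cbox a b) (nonlocal_diffusion (cbox a b) J w) w
      = (LINT x:cbox a b|lebesgue. (LINT y:cbox a b|lebesgue. k (x - y) * (w x - w y)) * w x)"
    unfolding L2_inner_def
    by (rule set_lebesgue_integral_cong) (simp_all add: inner)
  with nonneg show ?thesis by simp
qed

section \<open>Energy stability of the scheme\<close>

text \<open>A backward Euler step of a decay equation: \<open>R' (1 - \<tau> q) = R\<close> with \<open>1 - \<tau> q \<ge> 1\<close>.\<close>

lemma implicit_decay_step:
  fixes R R' \<tau> q :: real
  assumes step: "(R' - R) / \<tau> = R' * q" and "0 < \<tau>" "q \<le> 0" "0 < R"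
  shows "R' - R = R' * \<tau> * q" "0 < R'" "R' \<le> R"
proof -
  show eq: "R' - R = R' * \<tau> * q"
    using step \<open>0 < \<tau>\<close> by (simp add: field_simps)
  have neg: "\<tau> * q \<le> 0" using \<open>0 < \<tau>\<close> \<open>q \<le> 0\<close> by (simp add: mult_nonneg_nonpos)
  have "R' * (1 - \<tau> * q) = R" using eq by (simp add: algebra_simps)
  with neg \<open>0 < R\<close> show pos: "0 < R'" by (smt (verit) zero_less_mult_iff)
  have "R' * (\<tau> * q) \<le> 0" using pos neg by (simp add: mult_nonneg_nonpos)
  with eq show "R' \<le> R" by (simp add: mult.assoc)
qed

theorem theorem3p2:
  fixes a b :: "real ^ 'd"
    and J :: "real ^ 'd \<Rightarrow> real"
    and F f :: "real \<Rightarrow> real"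
    and M \<epsilon> \<Delta>t :: real
    and Nt :: nat
    and \<phi>0 :: "real ^ 'd \<Rightarrow> real"
    and ext :: "real \<Rightarrow> nat \<Rightarrow> (real ^ 'd \<Rightarrow> real) list \<Rightarrow> real ^ 'd \<Rightarrow> real"
    and \<phi> \<phi>s \<mu> :: "nat \<Rightarrow> real ^ 'd \<Rightarrow> real"
    and R \<xi> :: "nat \<Rightarrow> real"
  assumes dim: "CARD('d) \<in> {1, 2, 3}"
    and cell: "\<forall>i. a $ i < b $ i"
    and kernel: "interaction_kernel a b J"
    and potential: "C1_potential F f"
    and params: "0 < M" "0 < \<epsilon>" "\<epsilon> \<le> 1" "0 < \<Delta>t" "1 \<le> Nt"
    and approx: "explicit_second_order_approx a b J f M \<epsilon> \<phi>0 ext"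
    and phis: "\<forall>n<Nt. \<phi>s n = ext \<Delta>t n (map \<phi> [0..<Suc n])"
    and init: "\<phi> 0 = \<phi>0" "R 0 = exp (free_energy (cbox a b) J \<epsilon> F (\<phi> 0))"
    and reg0: "\<forall>n\<le>Nt. L2_periodic a b (\<phi> n)"
    and reg: "\<forall>n<Nt. L2_periodic a b (\<phi>s n) \<and> L2_periodic a b (\<mu> n) \<and>
                L2_on (cbox a b) (\<lambda>x. f (\<phi>s n x)) \<and>
                L2_on (cbox a b) (chemical_potential (cbox a b) J \<epsilon> f (\<phi>s n))"
    and fin: "finite_energy (cbox a b) J F (\<phi> 0)"
             "\<forall>n<Nt. finite_energy (cbox a b) J F (\<phi>s n)"
    and scheme: "CN_ESI_SAV_scheme (cbox a b) J F f M \<epsilon> \<Delta>t Nt \<phi>s \<phi> \<mu> R \<xi>"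
  shows "\<forall>n<Nt.
     (let \<mu>b = chemical_potential (cbox a b) J \<epsilon> f (\<phi>s n);
          D = R (n + 1) * \<Delta>t *
              L2_inner (cbox a b) (\<lambda>x. - M * nonlocal_diffusion (cbox a b) J \<mu>b x) \<mu>b
      in R (n + 1) - R n = D \<and> D \<le> 0) \<and>
     0 < R n \<and> 0 < R (n + 1) \<and>
     ln (R (n + 1)) - ln (R n) \<le> 0"
proof -
  let ?\<Omega> = "cbox a b"
  define \<mu>b where "\<mu>b n = chemical_potential ?\<Omega> J \<epsilon> f (\<phi>s n)" for n
  define q where "q n = L2_inner ?\<Omega> (\<lambda>x. - M * nonlocal_diffusion ?\<Omega> J (\<mu>b n) x) (\<mu>b n)" for n
  have q: "q n \<le> 0" if "n < Nt" for n
  proof -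
    have "q n = - M * L2_inner ?\<Omega> (nonlocal_diffusion ?\<Omega> J (\<mu>b n)) (\<mu>b n)"
      unfolding q_def L2_inner_def mult.assoc by (rule set_integral_mult_right)
    moreover have "0 \<le> L2_inner ?\<Omega> (nonlocal_diffusion ?\<Omega> J (\<mu>b n)) (\<mu>b n)"
      using reg that by (intro nonlocal_diffusion_nonneg[OF cell kernel]) (simp add: \<mu>b_def)
    ultimately show ?thesis using params(1) by simp
  qed
  have step: "(R (n + 1) - R n) / \<Delta>t = R (n + 1) * q n" if "n < Nt" for n
    using scheme that unfolding CN_ESI_SAV_scheme_def Let_def q_def \<mu>b_def by blast
  have pos: "0 < R n" if "n \<le> Nt" for n
    using that
  proof (induction n)
    case 0
    then show ?case by (simp add: init(2))
  next
    case (Suc n)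
    then show ?case using implicit_decay_step(2)[OF step[of n] params(4) q[of n]] by simp
  qed
  show ?thesis
  proof (intro allI impI)
    fix n assume n: "n < Nt"
    note decay = implicit_decay_step[OF step[OF n] params(4) q[OF n] pos[OF less_imp_le[OF n]]]
    have "R (n + 1) - R n = R (n + 1) * \<Delta>t * q n \<and> R (n + 1) * \<Delta>t * q n \<le> 0"
      using decay by simp
    moreover have "ln (R (n + 1)) - ln (R n) \<le> 0"
      using decay(2,3) by simp
    ultimately show "(let \<mu>b = chemical_potential ?\<Omega> J \<epsilon> f (\<phi>s n);
          D = R (n + 1) * \<Delta>t * L2_inner ?\<Omega> (\<lambda>x. - M * nonlocal_diffusion ?\<Omega> J \<mu>b x) \<mu>b
        in R (n + 1) - R n = D \<and> D \<le> 0) \<and>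
        0 < R n \<and> 0 < R (n + 1) \<and> ln (R (n + 1)) - ln (R n) \<le> 0"
      using decay(2) pos[of n] n by (simp add: Let_def q_def \<mu>b_def)
  qed
qed

end
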